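(* Consider the iteration $z_{n+1}=z_n^{\,x}+c$ with $z_0=i$ and $c=0$, and let $x_0:=2$. Then the following hold. (1) $x_0\in E(i,0)$. (2) For every $\varepsilon>0$, let $x_\pm=2\pm i\varepsilon$ and let $\{z_n^\pm\}_{n\ge0}$ denote the corresponding orbits (starting from $z_0^\pm=i$ with exponent $x_\pm$). Then $x_+\in E(i,0)$, while $x_-\notin E(i,0)$. In fact, $|z_n^+|\to 0$ and $|z_n^-|\to+\infty$ as $n\to\infty$. (3) Hence $x_0\in\partial E(i,0)$.
   Context: Complex powers: for $z\in\mathbb{C}\setminus\{0\}$ let $\log z=\ln|z|+i\operatorname{Arg}(z)$ with $\operatorname{Arg}(z)\in(-\pi,\pi]$ (so $\operatorname{Arg}(-a)=\pi$ for $a>0$), and for $x\in\mathbb{C}$ set $z^x=\exp(x\log z)$. For $z=0$: $0^x=0$ if $\operatorname{Re}(x)>0$, and $0^x$ is undefined if $\operatorname{Re}(x)\le 0$. For $(z_0,c,x)\in\mathbb{C}^3$, the orbit $\{z_n\}$ is generated by $z_{n+1}=z_n^{\,x}+c$, continuing as long as the next iterate is defined and terminating otherwise. Exponent Set: for fixed $z_0,c\in\mathbb{C}$, $E(z_0,c)$ is the set of all $x\in\mathbb{C}$ such that $z_n$ is defined for every $n\ge 0$ and $\sup_{n\ge0}|z_n|<\infty$. The symbol $\partial E(z_0,c)$ denotes its topological boundary in $\mathbb{C}$. *)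

theory Defs
  imports "HOL-Analysis.Analysis"
begin

text \<open>
  For nonzero base, the library's \<^term>\<open>z powr x\<close> on \<^typ>\<open>complex\<close> is
  \<^term>\<open>exp (x * Ln z)\<close>, where the imaginary part of \<^term>\<open>Ln z\<close> lies in the half-open
  interval from \<open>-\<pi>\<close> (excluded) to \<open>\<pi>\<close> (included). For base zero the library totalizes to
  \<open>0\<close>; here the power is undefined there, i.e. \<^term>\<open>None\<close>, unless the exponent has
  positive real part.
\<close>

definition cpow :: "complex \<Rightarrow> complex \<Rightarrow> complex option" where
  "cpow z x = (if z = 0 then (if Re x > 0 then Some 0 else None) else Some (z powr x))"

text \<open>\<^term>\<open>None\<close> from some index on means that the orbit has terminated.\<close>

primrec orbit :: "complex \<Rightarrow> complex \<Rightarrow> complex \<Rightarrow> nat \<Rightarrow> complex option" where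
  "orbit z0 c x 0 = Some z0"
| "orbit z0 c x (Suc n) =
     (case orbit z0 c x n of
        None \<Rightarrow> None
      | Some z \<Rightarrow> map_option (\<lambda>w. w + c) (cpow z x))"

definition exponent_set :: "complex \<Rightarrow> complex \<Rightarrow> complex set" where
  "exponent_set z0 c =
     {x. \<exists>z. (\<forall>n. orbit z0 c x n = Some (z n)) \<and> bdd_above (range (\<lambda>n. cmod (z n)))}"

end

theory Submission
  imports Defs
begin

text \<open>
  Write \<open>x = 2 + it\<close> with \<open>t\<close> real. In the logarithmic coordinate
  \<open>Ln z = r + i\<theta>\<close>, with \<open>-\<pi> < \<theta> \<le> \<pi>\<close>, one step of \<open>z \<mapsto> z powr x\<close> sends
  \<open>r\<close> to \<open>2r - t\<theta>\<close>. Hence \<open>u = -tr\<close> is sent to \<open>2u + t\<^sup>2\<theta> \<ge> 2u - \<pi>t\<^sup>2\<close>, whatever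
  the branch of the argument is: the excess \<open>u - \<pi>t\<^sup>2\<close> at least doubles, so it grows
  geometrically as soon as it is positive. Starting from \<open>\<i>\<close>, the first two steps can be
  computed exactly, because the argument is first \<open>\<pi>/2\<close> and then exactly the included endpoint
  \<open>\<pi>\<close>; after them \<open>u = 2\<pi>t\<^sup>2\<close>, with excess \<open>\<pi>t\<^sup>2\<close>, which is
  positive for \<open>t \<noteq> 0\<close> (lemma \<open>log_modulus_orbit_bound\<close>).

  Thus, for \<open>t \<noteq> 0\<close>, \<open>t ln|z\<^sub>n|\<close> tends to \<open>-\<infinity>\<close> at least like \<open>-\<pi>t\<^sup>2 2\<^sup>n\<^sup>-\<^sup>2\<close>, and the sign of \<open>t\<close> alone
  decides between \<open>|z\<^sub>n| \<rightarrow> 0\<close> and \<open>|z\<^sub>n| \<rightarrow> \<infinity>\<close>. For \<open>t = 0\<close> the modulus stays \<open>1\<close>.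
  The exponents \<open>2 - i\<epsilon>\<close>, which lie outside the exponent set, accumulate at its member \<open>2\<close>,
  which is therefore a boundary point.
\<close>

abbreviation powr_iter :: "complex \<Rightarrow> complex \<Rightarrow> nat \<Rightarrow> complex" where
  "powr_iter z0 x n \<equiv> ((\<lambda>w. w powr x) ^^ n) z0"

lemma powr_iter_nonzero: "z0 \<noteq> 0 \<Longrightarrow> powr_iter z0 x n \<noteq> 0"
  by (induction n) auto

text \<open>
  Complex powers of nonzero numbers are nonzero, so without an additive constant the undefined
  case \<open>0\<^sup>x\<close> is never met and the orbit never terminates.
\<close>

lemma orbit_zero_const:
  assumes "z0 \<noteq> 0"
  shows "orbit z0 0 x n = Some (powr_iter z0 x n)"
  using powr_iter_nonzero[OF assms]
  by (induction n) (auto simp: cpow_def assms)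

lemma exponent_set_zero_const_iff:
  assumes "z0 \<noteq> 0"
  shows "x \<in> exponent_set z0 0 \<longleftrightarrow> bdd_above (range (\<lambda>n. cmod (powr_iter z0 x n)))"
proof
  assume "x \<in> exponent_set z0 0"
  then obtain z where z: "\<And>n. orbit z0 0 x n = Some (z n)"
    and "bdd_above (range (\<lambda>n. cmod (z n)))"
    by (auto simp: exponent_set_def)
  moreover have "z = powr_iter z0 x"
    using z by (auto simp: orbit_zero_const[OF assms])
  ultimately show "bdd_above (range (\<lambda>n. cmod (powr_iter z0 x n)))"
    by simp
next
  assume "bdd_above (range (\<lambda>n. cmod (powr_iter z0 x n)))"
  then show "x \<in> exponent_set z0 0"
    unfolding exponent_set_def mem_Collect_eq
    using orbit_zero_const[OF assms] by (intro exI[of _ "powr_iter z0 x"]) simp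
qed

lemma ln_cmod_powr:
  assumes "w \<noteq> 0"
  shows "ln (cmod (w powr x)) = Re x * ln (cmod w) - Im x * Im (Ln w)"
  using assms by (simp add: powr_def norm_exp_eq_Re)

text \<open>
  The quantity \<open>u\<^sub>n = -t ln|z\<^sub>n|\<close> is bounded below in the form \<open>u\<^sub>n \<ge> \<pi>t\<^sup>2(1 + 2\<^sup>n\<^sup>-\<^sup>2)\<close>, shaped
  by the fixed point \<open>\<pi>t\<^sup>2\<close> of the worst-case recursion \<open>u \<mapsto> 2u - \<pi>t\<^sup>2\<close>. The bound starts
  at \<open>n = 2\<close>, where it is an equality: \<open>u\<^sub>0 = 0\<close> and \<open>u\<^sub>1 = \<pi>t\<^sup>2/2\<close> lie below the fixed
  point (unless \<open>t = 0\<close>), and it is the exact arguments \<open>\<pi>/2\<close> and \<open>\<pi>\<close> that carry \<open>u\<close> past it.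
\<close>

lemma log_modulus_orbit_bound:
  fixes t :: real
  defines "x \<equiv> Complex 2 t"
  shows "t * ln (cmod (powr_iter \<i> x (n + 2))) \<le> - (pi * t\<^sup>2 * (1 + 2 ^ n))"
proof (induction n)
  case 0
  \<comment> \<open>The argument \<open>\<pi>\<close> needs no reduction: it is the endpoint included in the principal range.\<close>
  have Ln1: "Ln (\<i> powr x) = Complex (- (pi * t / 2)) pi"
  proof -
    have "\<i> powr x = exp (Complex (- (pi * t / 2)) pi)"
      by (simp add: powr_def x_def complex_eq_iff Re_exp Im_exp)
    then show ?thesis
      using Ln_exp[of "Complex (- (pi * t / 2)) pi"] pi_gt_zero by simp
  qed
  have "ln (cmod ((\<i> powr x) powr x)) = - (2 * pi * t)"
    by (subst ln_cmod_powr) (simp_all add: Ln1[unfolded x_def] x_def flip: Re_Ln)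
  then show ?case
    by (simp add: numeral_2_eq_2 power2_eq_square algebra_simps)
next
  case (Suc n)
  let ?w = "powr_iter \<i> x (n + 2)"
  have w: "?w \<noteq> 0"
    by (rule powr_iter_nonzero) simp
  have "t * ln (cmod (powr_iter \<i> x (Suc n + 2))) = 2 * (t * ln (cmod ?w)) + t\<^sup>2 * (- Im (Ln ?w))"
  proof -
    have "ln (cmod (powr_iter \<i> x (Suc n + 2))) = 2 * ln (cmod ?w) - t * Im (Ln ?w)"
      using ln_cmod_powr[OF w, of x] by (simp add: x_def)
    then show ?thesis
      by (simp only: power2_eq_square) (simp only: algebra_simps)
  qed
  also have "\<dots> \<le> 2 * (- (pi * t\<^sup>2 * (1 + 2 ^ n))) + t\<^sup>2 * pi"
    using Suc.IH mpi_less_Im_Ln[OF w] by (intro add_mono mult_left_mono) auto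
  also have "\<dots> = - (pi * t\<^sup>2 * (1 + 2 ^ Suc n))"
    by (simp add: algebra_simps)
  finally show ?case .
qed

lemma filterlim_log_modulus_orbit:
  fixes t :: real
  assumes "t \<noteq> 0"
  shows "filterlim (\<lambda>n. t * ln (cmod (powr_iter \<i> (Complex 2 t) n))) at_bot sequentially"
proof -
  have "filterlim (\<lambda>n. pi * t\<^sup>2 * (1 + 2 ^ n)) at_top sequentially"
    using assms
    by (intro filterlim_tendsto_pos_mult_at_top[OF tendsto_const]
        filterlim_tendsto_add_at_top[OF tendsto_const])
      (auto intro!: filterlim_realpow_sequentially_gt1 filterlim_at_infinity_imp_filterlim_at_top)
  then have "filterlim (\<lambda>n. - (pi * t\<^sup>2 * (1 + 2 ^ n))) at_bot sequentially"
    by (simp add: filterlim_uminus_at_top)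
  then have "filterlim (\<lambda>n. t * ln (cmod (powr_iter \<i> (Complex 2 t) (n + 2)))) at_bot sequentially"
    by (rule filterlim_at_bot_mono)
      (use log_modulus_orbit_bound in \<open>auto intro: always_eventually\<close>)
  then show ?thesis
    using filterlim_sequentially_Suc[of "\<lambda>n. t * ln (cmod (powr_iter \<i> (Complex 2 t) n))" at_bot]
      filterlim_sequentially_Suc[of "\<lambda>n. t * ln (cmod (powr_iter \<i> (Complex 2 t) (Suc n)))" at_bot]
    by simp
qed

lemma orbit_modulus_tendsto_0:
  fixes t :: real
  assumes "t > 0"
  shows "(\<lambda>n. cmod (powr_iter \<i> (Complex 2 t) n)) \<longlonglongrightarrow> 0"
proof -
  let ?r = "\<lambda>n. cmod (powr_iter \<i> (Complex 2 t) n)"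
  have "filterlim (\<lambda>n. ln (?r n)) at_bot sequentially"
    using filterlim_log_modulus_orbit[of t] assms
    by (simp add: filterlim_tendsto_pos_mult_at_bot_iff[OF tendsto_const])
  then have "(\<lambda>n. exp (ln (?r n))) \<longlonglongrightarrow> 0"
    by (rule filterlim_compose[OF exp_at_bot])
  then show ?thesis
    by (simp add: powr_iter_nonzero)
qed

lemma orbit_modulus_at_top:
  fixes t :: real
  assumes "t < 0"
  shows "filterlim (\<lambda>n. cmod (powr_iter \<i> (Complex 2 t) n)) at_top sequentially"
proof -
  let ?r = "\<lambda>n. cmod (powr_iter \<i> (Complex 2 t) n)"
  have "filterlim (\<lambda>n. inverse t * (t * ln (?r n))) at_top sequentially"
    using filterlim_log_modulus_orbit[of t] assms
    by (subst filterlim_tendsto_neg_mult_at_top_iff[OF tendsto_const]) auto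
  then have "filterlim (\<lambda>n. ln (?r n)) at_top sequentially"
    using assms by (simp flip: mult.assoc)
  then have "filterlim (\<lambda>n. exp (ln (?r n))) at_top sequentially"
    by (rule filterlim_compose[OF exp_at_top])
  then show ?thesis
    by (simp add: powr_iter_nonzero)
qed

lemma cmod_powr_iter_2: "cmod (powr_iter \<i> 2 n) = 1"
  by (induction n) (simp_all add: norm_power)

lemma two_in_exponent_set: "2 \<in> exponent_set \<i> 0"
proof -
  have "bdd_above (range (\<lambda>n. cmod (powr_iter \<i> 2 n)))"
    by (rule bdd_aboveI2, rule eq_refl, rule cmod_powr_iter_2)
  then show ?thesis
    by (subst exponent_set_zero_const_iff) simp_all
qed

lemma positive_shift_in_exponent_set:
  fixes t :: real
  assumes "t > 0"
  shows "Complex 2 t \<in> exponent_set \<i> 0"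
  using convergent_imp_Bseq[OF convergentI[OF orbit_modulus_tendsto_0[OF assms]]]
  by (auto simp: exponent_set_zero_const_iff Bseq_eq_bounded bounded_imp_bdd_above)

lemma negative_shift_notin_exponent_set:
  fixes t :: real
  assumes "t < 0"
  shows "Complex 2 t \<notin> exponent_set \<i> 0"
proof
  assume "Complex 2 t \<in> exponent_set \<i> 0"
  then obtain B where B: "\<And>n. cmod (powr_iter \<i> (Complex 2 t) n) \<le> B"
    by (auto simp: exponent_set_zero_const_iff bdd_above_def)
  obtain n where "cmod (powr_iter \<i> (Complex 2 t) n) > B"
    using orbit_modulus_at_top[OF assms]
    by (auto simp: filterlim_at_top_dense eventually_sequentially)
  with B[of n] show False
    by simp
qed

lemma two_in_frontier: "2 \<in> frontier (exponent_set \<i> 0)"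
proof (subst frontier_straddle, intro allI impI conjI)
  fix e :: real
  assume "0 < e"
  then show "\<exists>x\<in>exponent_set \<i> 0. dist 2 x < e"
    using two_in_exponent_set by force
  have "dist 2 (Complex 2 (- (e / 2))) < e"
    using \<open>0 < e\<close> by (simp add: dist_norm cmod_def)
  moreover have "Complex 2 (- (e / 2)) \<notin> exponent_set \<i> 0"
    using \<open>0 < e\<close> by (intro negative_shift_notin_exponent_set) simp
  ultimately show "\<exists>x. x \<notin> exponent_set \<i> 0 \<and> dist 2 x < e"
    by blast
qed

theorem theorem3p7:
  shows "2 \<in> exponent_set \<i> 0 \<and>
    (\<forall>\<epsilon>::real. \<epsilon> > 0 \<longrightarrow>
       2 + \<i> * of_real \<epsilon> \<in> exponent_set \<i> 0 \<and>
       2 - \<i> * of_real \<epsilon> \<notin> exponent_set \<i> 0 \<and>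
       (\<exists>z. (\<forall>n. orbit \<i> 0 (2 + \<i> * of_real \<epsilon>) n = Some (z n)) \<and>
            (\<lambda>n. cmod (z n)) \<longlonglongrightarrow> 0) \<and>
       (\<exists>z. (\<forall>n. orbit \<i> 0 (2 - \<i> * of_real \<epsilon>) n = Some (z n)) \<and>
            filterlim (\<lambda>n. cmod (z n)) at_top sequentially)) \<and>
    2 \<in> frontier (exponent_set \<i> 0)"
proof (intro conjI allI impI)
  show "2 \<in> exponent_set \<i> 0" and "2 \<in> frontier (exponent_set \<i> 0)"
    by (fact two_in_exponent_set two_in_frontier)+
next
  fix \<epsilon> :: real
  assume eps: "\<epsilon> > 0"
  have plus: "2 + \<i> * of_real \<epsilon> = Complex 2 \<epsilon>" and minus: "2 - \<i> * of_real \<epsilon> = Complex 2 (- \<epsilon>)"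
    by (simp_all add: complex_eq_iff)
  show "2 + \<i> * of_real \<epsilon> \<in> exponent_set \<i> 0"
    unfolding plus using eps by (rule positive_shift_in_exponent_set)
  show "2 - \<i> * of_real \<epsilon> \<notin> exponent_set \<i> 0"
    unfolding minus using eps by (intro negative_shift_notin_exponent_set) simp
  show "\<exists>z. (\<forall>n. orbit \<i> 0 (2 + \<i> * of_real \<epsilon>) n = Some (z n)) \<and> (\<lambda>n. cmod (z n)) \<longlonglongrightarrow> 0"
    unfolding plus using orbit_zero_const[of \<i>] orbit_modulus_tendsto_0[OF eps] by auto
  show "\<exists>z. (\<forall>n. orbit \<i> 0 (2 - \<i> * of_real \<epsilon>) n = Some (z n)) \<and>
      filterlim (\<lambda>n. cmod (z n)) at_top sequentially"
    unfolding minus using orbit_zero_const[of \<i>] orbit_modulus_at_top[of "- \<epsilon>"] eps by auto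
qed

end
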